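(* Let $\mathcal{R}_{\text{BL}}$ be the range family of all bottomless rectangles in $\mathbb{R}^2$ and let $m$ be a positive integer. Then for any finite point set $V \subset \mathbb{R}^2$ in general position, the hypergraph $\mathcal{H}(V,\mathcal{R}_{\text{BL}},m)$ admits a $10$-shallow hitting set $X \subseteq V$.
   Context: The family of all bottomless rectangles is $\mathcal{R}_{\text{BL}} = \{ [a,b] \times (-\infty,c] \mid a,b,c \in \mathbb{R} \}$. For a range family $\mathcal{R}$ (a family of subsets of $\mathbb{R}^2$), a finite point set $V \subset \mathbb{R}^2$ and a positive integer $m$, $\mathcal{H}(V,\mathcal{R},m)$ is the hypergraph with vertex set $V$ whose hyperedges are exactly the subsets $e \subseteq V$ with $|e| = m$ for which there is some $R \in \mathcal{R}$ with $e = V \cap R$. General position means that distinct points of $V$ have different $x$-coordinates and different $y$-coordinates. For a hypergraph with vertex set $V$ and hyperedge set $E$ and a positive integer $t$, a $t$-shallow hitting set is a subset $X \subseteq V$ with $1 \leq |e \cap X| \leq t$ for every $e \in E$. *)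

theory Defs
  imports Complex_Main
begin

definition bottomless_rectangles :: "(real \<times> real) set set" where
  "bottomless_rectangles = {{a..b} \<times> {..c} | a b c. True}"

definition general_position :: "(real \<times> real) set \<Rightarrow> bool" where
  "general_position V \<longleftrightarrow>
     (\<forall>p\<in>V. \<forall>q\<in>V. p \<noteq> q \<longrightarrow> fst p \<noteq> fst q \<and> snd p \<noteq> snd q)"

text \<open>A hypergraph is a pair of a vertex set and a set of hyperedges.\<close>

type_synonym 'a hypergraph = "'a set \<times> 'a set set"

definition range_hypergraph ::
    "(real \<times> real) set \<Rightarrow> (real \<times> real) set set \<Rightarrow> nat \<Rightarrow> (real \<times> real) hypergraph" where
  "range_hypergraph V \<R> m = (V, {e. e \<subseteq> V \<and> card e = m \<and> (\<exists>R\<in>\<R>. e = V \<inter> R)})"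

text \<open>An infinite intersection has \<^term>\<open>card\<close> 0 and is thus excluded by the lower bound.\<close>

definition shallow_hitting_set :: "nat \<Rightarrow> 'a hypergraph \<Rightarrow> 'a set \<Rightarrow> bool" where
  "shallow_hitting_set t H X \<longleftrightarrow>
     X \<subseteq> fst H \<and> (\<forall>e\<in>snd H. 1 \<le> card (e \<inter> X) \<and> card (e \<inter> X) \<le> t)"

end

theory Submission
  imports Defs
begin

text \<open>
  Sweep the plane upwards. At each moment the points met so far form a finite subset of the
  $x$-axis, and a hyperedge is a window: $m$ consecutive points of this subset at some moment.
  Points are only ever inserted, so the task is to choose $X$ such that every window at every
  moment contains between 1 and 10 elements of $X$.

  Let $s = \lceil m/4 \rceil$. Once $s$ points have been met, the axis stays partitioned into intervals that
  each hold between $s$ and $2s - 1$ points; an interval that reaches $2s$ points is cut in the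
  middle into two intervals with $s$ points each. The points that an interval holds when it is
  created are its core. The set $X$ is built so that every core contains exactly one element
  of $X$. This can be arranged at each cut: a half inherits at most one chosen point from the old
  core. If it inherits none, then it does not consist of old core points only, because the old
  core has $s$ points, one of them chosen, and the half has $s$ points too. So it holds a point
  that arrived later; such points have never been considered before, and one of them is chosen.
  Points that have belonged to a core are never chosen afterwards. This makes the bounds final:
  the points of an interval at any moment of its life include its core, and they are included in the
  two cores that it is cut into, unless it is never cut and only the chosen point of its core ever
  counts. Hence they contain one or two elements of the finished set $X$, including those chosen
  long after that moment (lemma \<open>sweep\<close>).

  It remains to compare windows with intervals (lemma \<open>balanced_window\<close>). As
  $m \ge 4s - 3$, a window contains all points of some interval, and as $m \le 4s$, it meets at
  most five intervals, which contribute at most two chosen points each.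
\<close>

section \<open>Partitions of the line into intervals\<close>

definition interval_partition :: "'a::linorder set set \<Rightarrow> bool" where
  "interval_partition \<C> \<longleftrightarrow>
     finite \<C> \<and> (\<forall>x. \<exists>!C. C \<in> \<C> \<and> x \<in> C) \<and> (\<forall>C\<in>\<C>. \<forall>x\<in>C. \<forall>y\<in>C. {x..y} \<subseteq> C)"

text \<open>
  The set \<open>X\<close> may contain elements outside \<open>P\<close>: it is the finished set, whereas \<open>P\<close> is the
  set of points present at one moment of the sweep.
\<close>

definition balanced :: "nat \<Rightarrow> 'a::linorder set \<Rightarrow> 'a set set \<Rightarrow> 'a set \<Rightarrow> bool" where
  "balanced s X \<C> P \<longleftrightarrow> interval_partition \<C> \<and>
     (\<forall>C\<in>\<C>. s \<le> card (C \<inter> P) \<and> card (C \<inter> P) < 2 * s \<and>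
            1 \<le> card (C \<inter> P \<inter> X) \<and> card (C \<inter> P \<inter> X) \<le> 2)"

lemma interval_partition_unique:
  assumes "interval_partition \<C>" "C \<in> \<C>" "D \<in> \<C>" "x \<in> C" "x \<in> D"
  shows "C = D"
  using assms unfolding interval_partition_def by blast

lemma interval_partition_cover:
  assumes "interval_partition \<C>"
  obtains C where "C \<in> \<C>" "x \<in> C"
  using assms unfolding interval_partition_def by blast

lemma interval_partition_convex:
  assumes "interval_partition \<C>" "C \<in> \<C>" "x \<in> C" "y \<in> C" "x \<le> z" "z \<le> y"
  shows "z \<in> C"
proof -
  have "{x..y} \<subseteq> C" using assms(1-4) unfolding interval_partition_def by blast
  then show ?thesis using assms(5,6) by auto
qed

lemma interval_partition_split:
  assumes part: "interval_partition \<C>" and C: "C \<in> \<C>"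
  shows "interval_partition (\<C> - {C} \<union> {C \<inter> {..t}, C \<inter> {t<..}})"
  unfolding interval_partition_def
proof (intro conjI allI)
  let ?N = "\<C> - {C} \<union> {C \<inter> {..t}, C \<inter> {t<..}}"
  show "finite ?N" using part unfolding interval_partition_def by simp
  show "\<exists>!D. D \<in> ?N \<and> x \<in> D" for x
  proof -
    obtain E where E: "E \<in> \<C>" "x \<in> E" by (rule interval_partition_cover[OF part])
    have uniq: "F = E" if "F \<in> \<C>" "x \<in> F" for F
      using interval_partition_unique[OF part] that E by blast
    show ?thesis
    proof (cases "E = C")
      case False
      then show ?thesis using E uniq C by (intro ex1I[of _ E]) blast+
    next
      case True
      have "x \<in> C \<inter> {..t} \<longleftrightarrow> x \<le> t" "x \<in> C \<inter> {t<..} \<longleftrightarrow> \<not> x \<le> t" using E True by auto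
      then show ?thesis using uniq True by (cases "x \<le> t") blast+
    qed
  qed
  note conv = interval_partition_convex[OF part]
  show "\<forall>D\<in>?N. \<forall>x\<in>D. \<forall>y\<in>D. {x..y} \<subseteq> D"
  proof (intro ballI subsetI)
    fix D x y z assume "D \<in> ?N" and xy: "x \<in> D" "y \<in> D" and "z \<in> {x..y}"
    then have z: "x \<le> z" "z \<le> y" by auto
    from \<open>D \<in> ?N\<close> consider "D \<in> \<C>" | "D = C \<inter> {..t}" | "D = C \<inter> {t<..}" by blast
    then show "z \<in> D"
    proof cases
      case 1
      then show ?thesis using conv xy z by blast
    next
      case 2
      then show ?thesis using conv[OF C, of x y z] xy z by auto
    next
      case 3
      then show ?thesis using conv[OF C, of x y z] xy z by auto
    qed
  qed
qed

section \<open>Windows of consecutive points\<close>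

text \<open>
  An interval that meets a window but sticks out of it contains the first or the last point of the
  window, so there are at most two such intervals, and each of them shares at most $2s - 2$ points
  with the window. Having at least $4s - 3$ points, the window therefore contains all points of
  some interval. For the upper bound, every contained interval takes up $s$ of the at most $4s$
  points and every other one at least one point: either there are four contained intervals and
  nothing else, or at most three contained ones and at most two others.
\<close>

lemma balanced_window:
  fixes P :: "'a::linorder set"
  assumes bal: "balanced s X \<C> P" and P: "finite P" and s: "s \<ge> 1"
    and m: "4 * s - 3 \<le> card (P \<inter> {a..b})" "card (P \<inter> {a..b}) \<le> 4 * s"
  shows "1 \<le> card (P \<inter> {a..b} \<inter> X)" "card (P \<inter> {a..b} \<inter> X) \<le> 10"
proof -
  define e where "e = P \<inter> {a..b}"
  define A where "A = {C \<in> \<C>. C \<inter> e \<noteq> {} \<and> \<not> C \<inter> P \<subseteq> e}"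
  define D where "D = {C \<in> \<C>. C \<inter> e \<noteq> {} \<and> C \<inter> P \<subseteq> e}"
  have part: "interval_partition \<C>" using bal unfolding balanced_def by simp
  have fin: "finite A" "finite D" "finite e"
    using part P unfolding A_def D_def e_def interval_partition_def by auto
  have "card e \<ge> 1" using m s unfolding e_def by linarith
  then have "e \<noteq> {}" by auto
  obtain L where L: "L \<in> \<C>" "Min e \<in> L" by (rule interval_partition_cover[OF part])
  obtain H where H: "H \<in> \<C>" "Max e \<in> H" by (rule interval_partition_cover[OF part])
  have "A \<subseteq> {L, H}"
  proof
    fix C assume "C \<in> A"
    then obtain x z where C: "C \<in> \<C>" "x \<in> C" "x \<in> e" "z \<in> C" "z \<in> P" "z \<notin> e"
      unfolding A_def by blast
    have lo: "Min e \<in> e" "Min e \<le> x" and hi: "Max e \<in> e" "x \<le> Max e"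
      using fin C \<open>e \<noteq> {}\<close> by auto
    have "z < a \<or> b < z" using C unfolding e_def by auto
    moreover have "a \<le> Min e" "Max e \<le> b" using lo hi unfolding e_def by auto
    ultimately have "z \<le> Min e \<or> Max e \<le> z" by auto
    then have "Min e \<in> C \<or> Max e \<in> C"
      using interval_partition_convex[OF part C(1), of z x "Min e"]
        interval_partition_convex[OF part C(1), of x z "Max e"] lo hi C by blast
    then have "C = L \<or> C = H"
      using interval_partition_unique[OF part C(1)] L H by blast
    then show "C \<in> {L, H}" by blast
  qed
  then have "card A \<le> card {L, H}" by (intro card_mono) auto
  also have "\<dots> \<le> 2" by (simp add: card_insert_if)
  finally have cardA: "card A \<le> 2" .
  have disj: "C \<inter> C' = {}" if "C \<in> A \<union> D" "C' \<in> A \<union> D" "C \<noteq> C'" for C C'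
    using interval_partition_unique[OF part, of C C'] that unfolding A_def D_def by blast
  have cover: "\<exists>C \<in> A \<union> D. x \<in> C" if "x \<in> e" for x
  proof -
    obtain C where C: "C \<in> \<C>" "x \<in> C" by (rule interval_partition_cover[OF part])
    then have "C \<inter> e \<noteq> {}" using that by auto
    then show ?thesis using C unfolding A_def D_def by (cases "C \<inter> P \<subseteq> e") auto
  qed
  have AD: "A \<inter> D = {}" unfolding A_def D_def by auto
  have e_union: "e = (\<Union>C \<in> A \<union> D. C \<inter> e)" using cover by auto
  have "card e = (\<Sum>C \<in> A \<union> D. card (C \<inter> e))"
  proof -
    have "\<forall>C \<in> A \<union> D. \<forall>C' \<in> A \<union> D. C \<noteq> C' \<longrightarrow> (C \<inter> e) \<inter> (C' \<inter> e) = {}"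
      using disj by blast
    then have "card (\<Union>C \<in> A \<union> D. C \<inter> e) = (\<Sum>C \<in> A \<union> D. card (C \<inter> e))"
      using fin by (intro card_UN_disjoint) auto
    then show ?thesis using e_union by simp
  qed
  also have "\<dots> = (\<Sum>C\<in>A. card (C \<inter> e)) + (\<Sum>C\<in>D. card (C \<inter> e))"
    using fin AD by (simp add: sum.union_disjoint)
  finally have sum_e: "card e = (\<Sum>C\<in>A. card (C \<inter> e)) + (\<Sum>C\<in>D. card (C \<inter> e))" .
  have "(\<Sum>C\<in>A. card (C \<inter> e)) \<le> card A * (2 * s - 2)"
  proof (rule sum_bounded_above[where 'a = nat, simplified])
    fix C assume "C \<in> A"
    then have "C \<inter> e \<subset> C \<inter> P" "C \<in> \<C>" unfolding A_def e_def by auto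
    then have "card (C \<inter> e) < card (C \<inter> P)" "card (C \<inter> P) < 2 * s"
      using P bal by (auto intro: psubset_card_mono simp: balanced_def)
    then show "card (C \<inter> e) \<le> 2 * s - 2" by linarith
  qed
  also have "\<dots> \<le> 2 * (2 * s - 2)" using cardA by simp
  also have "\<dots> < card e" using m s unfolding e_def by linarith
  finally have "D \<noteq> {}" using sum_e by auto
  then obtain C where "C \<in> \<C>" "C \<inter> P \<subseteq> e" unfolding D_def by blast
  then have "1 \<le> card (C \<inter> P \<inter> X)" "C \<inter> P \<inter> X \<subseteq> e \<inter> X"
    using bal unfolding balanced_def by auto
  then show "1 \<le> card (P \<inter> {a..b} \<inter> X)"
    using fin card_mono[of "e \<inter> X" "C \<inter> P \<inter> X"] unfolding e_def by auto
  have "card D * s \<le> (\<Sum>C\<in>D. card (C \<inter> e))"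
  proof (rule sum_bounded_below[where 'a = nat, simplified])
    fix C assume "C \<in> D"
    then have "C \<inter> e = C \<inter> P" "C \<in> \<C>" unfolding D_def e_def by auto
    then show "s \<le> card (C \<inter> e)" using bal unfolding balanced_def by simp
  qed
  moreover have "card A * 1 \<le> (\<Sum>C\<in>A. card (C \<inter> e))"
  proof (rule sum_bounded_below[where 'a = nat, simplified])
    fix C assume "C \<in> A"
    then show "1 \<le> card (C \<inter> e)" using fin unfolding A_def by (auto simp: Suc_le_eq card_gt_0_iff)
  qed
  ultimately have count: "card A + card D * s \<le> 4 * s" using sum_e m unfolding e_def by simp
  have "card D \<le> 4"
  proof (rule ccontr)
    assume "\<not> card D \<le> 4"
    then have "5 * s \<le> card D * s" by (intro mult_right_mono) auto
    then show False using count s by linarith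
  qed
  moreover have "card D \<noteq> 4" if "card A \<noteq> 0" using that count by auto
  ultimately have five: "card A + card D \<le> 5" using cardA by linarith
  have "e \<inter> X \<subseteq> (\<Union>C \<in> A \<union> D. C \<inter> P \<inter> X)"
  proof
    fix x assume x: "x \<in> e \<inter> X"
    then obtain C where "C \<in> A \<union> D" "x \<in> C" using cover by blast
    then show "x \<in> (\<Union>C \<in> A \<union> D. C \<inter> P \<inter> X)" using x unfolding e_def by blast
  qed
  then have "card (e \<inter> X) \<le> card (\<Union>C \<in> A \<union> D. C \<inter> P \<inter> X)"
    using fin P by (intro card_mono) auto
  also have "\<dots> \<le> (\<Sum>C \<in> A \<union> D. card (C \<inter> P \<inter> X))"
    using fin by (intro card_UN_le) auto
  also have "\<dots> \<le> card (A \<union> D) * 2"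
  proof (rule sum_bounded_above[where 'a = nat, simplified])
    fix C assume "C \<in> A \<union> D"
    then show "card (C \<inter> P \<inter> X) \<le> 2" using bal unfolding A_def D_def balanced_def by auto
  qed
  also have "\<dots> \<le> 10" using five card_Un_le[of A D] by linarith
  finally show "card (P \<inter> {a..b} \<inter> X) \<le> 10" unfolding e_def by simp
qed

section \<open>The sweep\<close>

lemma split_at_rank:
  fixes B :: "'a::linorder set"
  assumes "finite B" "s \<ge> 1" "s \<le> card B"
  shows "\<exists>t. card (B \<inter> {..t}) = s"
  using assms(2,3,1)
proof (induction s rule: nat_induct_at_least)
  case base
  then have "B \<noteq> {}" by auto
  then have "Min B \<in> B" using base by (intro Min_in) auto
  then have "B \<inter> {..Min B} = {Min B}" using base by (auto intro: antisym)
  then show ?case by (intro exI[of _ "Min B"]) simp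
next
  case (Suc s)
  then obtain t where t: "card (B \<inter> {..t}) = s" by auto
  let ?R = "B \<inter> {t<..}"
  have "B = B \<inter> {..t} \<union> ?R" by auto
  then have "?R \<noteq> {}" using t Suc by (metis Suc_n_not_le_n sup_bot_right)
  then have R: "Min ?R \<in> ?R" using Suc by (intro Min_in) auto
  have "x = Min ?R" if "x \<in> ?R" "x \<le> Min ?R" for x
    using that Suc by (intro antisym) auto
  then have "B \<inter> {..Min ?R} = insert (Min ?R) (B \<inter> {..t})" using R by force
  moreover have "Min ?R \<notin> B \<inter> {..t}" using R by auto
  ultimately have "card (B \<inter> {..Min ?R}) = Suc s" using t Suc by simp
  then show ?case by blast
qed

text \<open>
  The choice made for one half \<open>C'\<close> of an interval \<open>C\<close> that is being cut. Here \<open>B\<close> is the set of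
  present points of the interval, \<open>K\<close> the set of all points that have belonged to a core, and \<open>X\<close>
  the set of points chosen so far. If the half inherits no chosen point, then its points cannot all
  be core points of \<open>C\<close>: they would then be the whole core, which contains a chosen point.
\<close>

lemma pick_in_half:
  assumes finK: "finite (C \<inter> K)" and "card (C \<inter> K) = card (B \<inter> C')"
    and "card (C \<inter> X) = 1" "X \<subseteq> K" "C' \<subseteq> C"
  shows "\<exists>Y \<subseteq> B \<inter> C' - K. card (C' \<inter> (X \<union> Y)) = 1"
proof (cases "C' \<inter> X = {}")
  case False
  have "finite (C \<inter> X)" using assms(3) by (intro card_ge_0_finite) simp
  moreover have sub: "C' \<inter> X \<subseteq> C \<inter> X" using assms(5) by auto
  ultimately have "card (C' \<inter> X) \<le> 1" "finite (C' \<inter> X)"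
    using assms(3) card_mono[of "C \<inter> X" "C' \<inter> X"] finite_subset[OF sub] by auto
  moreover from this have "card (C' \<inter> X) \<noteq> 0" using False by simp
  ultimately have "card (C' \<inter> X) = 1" by linarith
  then show ?thesis by (intro exI[of _ "{}"]) simp
next
  case True
  have "\<not> B \<inter> C' \<subseteq> K"
  proof
    assume sub: "B \<inter> C' \<subseteq> K"
    have "B \<inter> C' \<subseteq> C \<inter> K" using sub assms(5) by blast
    then have "B \<inter> C' = C \<inter> K" using assms(2) finK by (intro card_subset_eq) auto
    moreover have "C \<inter> X \<noteq> {}" using assms(3) by auto
    ultimately show False using assms(4) True by blast
  qed
  then obtain y where "y \<in> B \<inter> C' - K" by blast
  moreover from this have "C' \<inter> (X \<union> {y}) = {y}" using True by auto
  then have "card (C' \<inter> (X \<union> {y})) = 1" by (metis is_singletonI is_singleton_altdef)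
  ultimately show ?thesis by (intro exI[of _ "{y}"]) blast
qed

text \<open>
  The invariant of the sweep. The current points are \<open>P\<close>, those still to come are listed in \<open>ps\<close>
  in order of arrival, \<open>K\<close> is the set of points that have belonged to a core, and \<open>X0\<close> is the set
  of points chosen so far. The intersection of \<open>K\<close> with an interval of the current partition is the
  core of that interval. The conclusion \<open>X \<inter> K = X0\<close> says that the fate of core points is
  settled; it is what bounds the number of chosen points for moments before a cut in terms of the
  situation after it.

  The induction runs over the future points, so that the finished set \<open>X\<close> is supplied by the
  induction hypothesis and only the present moment has to be checked for it.
\<close>

lemma sweep:
  fixes P :: "'a::linorder set"
  assumes "s \<ge> 1" "finite P" "interval_partition \<C>" "X0 \<subseteq> K" "K \<subseteq> P"
    and "\<forall>C\<in>\<C>. card (C \<inter> K) = s \<and> card (C \<inter> X0) = 1 \<and> card (C \<inter> P) < 2 * s"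
    and "distinct ps" "set ps \<inter> P = {}"
  shows "\<exists>X \<subseteq> P \<union> set ps. X \<inter> K = X0 \<and> balanced s X \<C> P \<and>
           (\<forall>k. \<exists>\<C>'. balanced s X \<C>' (P \<union> set (take k ps)))"
  using assms
proof (induction ps arbitrary: P \<C> K X0)
  case Nil
  have "balanced s X0 \<C> P"
    unfolding balanced_def
  proof (intro conjI ballI)
    fix C assume C: "C \<in> \<C>"
    have "C \<inter> P \<inter> X0 = C \<inter> X0" using Nil by auto
    then show "1 \<le> card (C \<inter> P \<inter> X0)" "card (C \<inter> P \<inter> X0) \<le> 2" using C Nil by auto
    show "card (C \<inter> P) < 2 * s" using C Nil by auto
    show "s \<le> card (C \<inter> P)" using C Nil card_mono[of "C \<inter> P" "C \<inter> K"] by auto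
  qed (use Nil in simp)
  then show ?case using Nil by (intro exI[of _ X0]) auto
next
  case (Cons p ps)
  note part = \<open>interval_partition \<C>\<close>
  define Q where "Q = insert p P"
  have Q: "finite Q" "P \<subseteq> Q" "set ps \<inter> Q = {}" "distinct ps" "p \<notin> P"
    using Cons unfolding Q_def by auto
  \<comment> \<open>The lower bounds at the present moment come from the cores; only the upper bound on the number
    of chosen points depends on how the partition is continued.\<close>
  have step: ?case
    if X: "X \<subseteq> Q \<union> set ps" "X \<inter> K = X0" "\<forall>C\<in>\<C>. card (C \<inter> P \<inter> X) \<le> 2"
      and bal: "balanced s X \<D> Q" "\<forall>k. \<exists>\<C>'. balanced s X \<C>' (Q \<union> set (take k ps))" for X \<D>
  proof -
    have now: "balanced s X \<C> P"
      unfolding balanced_def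
    proof (intro conjI ballI)
      fix C assume C: "C \<in> \<C>"
      have "card (C \<inter> X0) \<le> card (C \<inter> P \<inter> X)" using X Cons.prems by (intro card_mono) auto
      then show "1 \<le> card (C \<inter> P \<inter> X)" using C Cons.prems by auto
      show "card (C \<inter> P \<inter> X) \<le> 2" using X C by auto
      show "card (C \<inter> P) < 2 * s" using C Cons.prems by auto
      show "s \<le> card (C \<inter> P)" using C Cons.prems card_mono[of "C \<inter> P" "C \<inter> K"] by auto
    qed (use part in simp)
    moreover have "\<exists>\<C>'. balanced s X \<C>' (P \<union> set (take k (p # ps)))" for k
    proof (cases k)
      case 0
      then show ?thesis using now by auto
    next
      case (Suc j)
      then show ?thesis using bal(2) unfolding Q_def by simp
    qed
    ultimately show ?thesis using X unfolding Q_def by (intro exI[of _ X]) auto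
  qed
  obtain C where C: "C \<in> \<C>" "p \<in> C" by (rule interval_partition_cover[OF part])
  have other: "D \<inter> C = {}" if "D \<in> \<C>" "D \<noteq> C" for D
    using interval_partition_unique[OF part] C that by blast
  then have otherQ: "D \<inter> Q = D \<inter> P" if "D \<in> \<C>" "D \<noteq> C" for D
    using C that unfolding Q_def by auto
  define B where "B = C \<inter> Q"
  have "B = insert p (C \<inter> P)" using C unfolding B_def Q_def by auto
  then have cardB: "card B = Suc (card (C \<inter> P))" using Q Cons.prems by simp
  show ?case
  proof (cases "card B < 2 * s")
    case True
    then have inv: "\<forall>D\<in>\<C>. card (D \<inter> K) = s \<and> card (D \<inter> X0) = 1 \<and> card (D \<inter> Q) < 2 * s"
      using Cons.prems(6) otherQ unfolding B_def by metis
    have "K \<subseteq> Q" using Cons.prems(5) Q by blast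
    then obtain X where X: "X \<subseteq> Q \<union> set ps" "X \<inter> K = X0" "balanced s X \<C> Q"
        "\<forall>k. \<exists>\<C>'. balanced s X \<C>' (Q \<union> set (take k ps))"
      using Cons.IH[OF Cons.prems(1) Q(1) part Cons.prems(4) _ inv Q(4,3)] by blast
    have "card (D \<inter> P \<inter> X) \<le> 2" if "D \<in> \<C>" for D
    proof -
      have "card (D \<inter> P \<inter> X) \<le> card (D \<inter> Q \<inter> X)" using Q by (intro card_mono) auto
      also have "\<dots> \<le> 2" using X that unfolding balanced_def by auto
      finally show ?thesis .
    qed
    then show ?thesis by (intro step[OF X(1,2) _ X(3,4)]) blast
  next
    case False
    moreover have "card (C \<inter> P) < 2 * s" using Cons.prems(6) C(1) by blast
    ultimately have card2: "card B = 2 * s" using cardB by linarith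
    have finB: "finite B" using Q unfolding B_def by simp
    \<comment> \<open>The interval is full and is cut at \<open>t\<close>; all its points become core points.\<close>
    obtain t where t: "card (B \<inter> {..t}) = s"
      using split_at_rank[of B s] finB card2 Cons.prems by auto
    define C1 where "C1 = C \<inter> {..t}"
    define C2 where "C2 = C \<inter> {t<..}"
    have C12: "C1 \<union> C2 = C" "C1 \<inter> C2 = {}" unfolding C1_def C2_def by auto
    have B1: "card (B \<inter> C1) = s" using t unfolding C1_def B_def by (simp add: Int_ac)
    have "B = (B \<inter> C1) \<union> (B \<inter> C2)" using C12(1) unfolding B_def by blast
    then have "card B = card (B \<inter> C1) + card (B \<inter> C2)"
      using card_Un_disjoint[of "B \<inter> C1" "B \<inter> C2"] finB C12(2)
      by (metis Int_assoc Int_empty_right finite_Int inf_left_commute)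
    then have B2: "card (B \<inter> C2) = s" using B1 card2 by simp
    have CK: "card (C \<inter> K) = s" "card (C \<inter> X0) = 1" using C Cons.prems by auto
    have finCK: "finite (C \<inter> K)" using Cons.prems by (meson finite_Int finite_subset)
    obtain Y1 where Y1: "Y1 \<subseteq> B \<inter> C1 - K" "card (C1 \<inter> (X0 \<union> Y1)) = 1"
      using pick_in_half[OF finCK, of B C1 X0] CK B1 C12 Cons.prems(4) by (metis Un_upper1)
    obtain Y2 where Y2: "Y2 \<subseteq> B \<inter> C2 - K" "card (C2 \<inter> (X0 \<union> Y2)) = 1"
      using pick_in_half[OF finCK, of B C2 X0] CK B2 C12 Cons.prems(4) by (metis Un_upper2)
    define X1 where "X1 = X0 \<union> Y1 \<union> Y2"
    define K1 where "K1 = K \<union> B"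
    define \<D> where "\<D> = \<C> - {C} \<union> {C1, C2}"
    have X1: "C1 \<inter> X1 = C1 \<inter> (X0 \<union> Y1)" "C2 \<inter> X1 = C2 \<inter> (X0 \<union> Y2)"
      using Y1 Y2 C12 unfolding X1_def by auto
    have K1: "C1 \<inter> K1 = B \<inter> C1" "C2 \<inter> K1 = B \<inter> C2" "C1 \<inter> Q = B \<inter> C1" "C2 \<inter> Q = B \<inter> C2"
      using C12 Cons.prems Q unfolding K1_def B_def by auto
    have partD: "interval_partition \<D>"
      unfolding \<D>_def C1_def C2_def by (rule interval_partition_split[OF part C(1)])
    have inv: "\<forall>D\<in>\<D>. card (D \<inter> K1) = s \<and> card (D \<inter> X1) = 1 \<and> card (D \<inter> Q) < 2 * s"
    proof
      fix D assume "D \<in> \<D>"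
      then consider "D = C1" | "D = C2" | "D \<in> \<C>" "D \<noteq> C" unfolding \<D>_def by auto
      then show "card (D \<inter> K1) = s \<and> card (D \<inter> X1) = 1 \<and> card (D \<inter> Q) < 2 * s"
      proof cases
        case 3
        then have "D \<inter> C = {}" by (rule other)
        then have "D \<inter> K1 = D \<inter> K" "D \<inter> X1 = D \<inter> X0"
          using Y1 Y2 unfolding K1_def X1_def B_def by auto
        then show ?thesis using 3 otherQ Cons.prems(6) by auto
      qed (use X1 K1 Y1 Y2 B1 B2 Cons.prems(1) in auto)
    qed
    have "X1 \<subseteq> K1" "K1 \<subseteq> Q"
      using Y1 Y2 Q Cons.prems unfolding X1_def K1_def B_def by auto
    then obtain X where X: "X \<subseteq> Q \<union> set ps" "X \<inter> K1 = X1" "balanced s X \<D> Q"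
        "\<forall>k. \<exists>\<C>'. balanced s X \<C>' (Q \<union> set (take k ps))"
      using Cons.IH[OF Cons.prems(1) Q(1) partD _ _ inv Q(4,3)] by blast
    have "X \<inter> K = X1 \<inter> K" using X(2) unfolding K1_def by auto
    also have "\<dots> = X0" using Y1 Y2 Cons.prems unfolding X1_def by auto
    finally have XK: "X \<inter> K = X0" .
    have "card (D \<inter> P \<inter> X) \<le> 2" if D: "D \<in> \<C>" for D
    proof (cases "D = C")
      case False
      then have "D \<in> \<D>" using D unfolding \<D>_def by auto
      then have "card (D \<inter> Q \<inter> X) \<le> 2" using X unfolding balanced_def by auto
      then show ?thesis using otherQ[OF D False] by simp
    next
      case True
      have fin: "finite (C1 \<inter> X1)" "finite (C2 \<inter> X1)"
        using X1 Y1 Y2 by (auto intro: card_ge_0_finite)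
      \<comment> \<open>The points of the cut interval are now core points, so no further ones get chosen.\<close>
      have "D \<inter> P \<inter> X \<subseteq> (C1 \<inter> X1) \<union> (C2 \<inter> X1)"
        using True C12 X(2) Q unfolding K1_def B_def by blast
      then have "card (D \<inter> P \<inter> X) \<le> card ((C1 \<inter> X1) \<union> (C2 \<inter> X1))"
        using fin by (intro card_mono) auto
      also have "\<dots> \<le> card (C1 \<inter> X1) + card (C2 \<inter> X1)" by (rule card_Un_le)
      also have "\<dots> = 2" using X1 Y1 Y2 by simp
      finally show ?thesis .
    qed
    then show ?thesis by (intro step[OF X(1) XK _ X(3,4)]) blast
  qed
qed

text \<open>
  The one-dimensional form of the result, with moments of the sweep given as prefixes of a list.
  The sweep starts once \<open>s\<close> points are present: these form the core of the whole line, and any one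
  of them may be chosen. No window exists earlier, because $s \le m$.
\<close>

lemma shallow_hitting_set_consecutive:
  fixes ps :: "'a::linorder list"
  assumes "m > 0" "distinct ps"
  shows "\<exists>X \<subseteq> set ps. \<forall>k a b. card (set (take k ps) \<inter> {a..b}) = m \<longrightarrow>
           1 \<le> card (set (take k ps) \<inter> {a..b} \<inter> X) \<and> card (set (take k ps) \<inter> {a..b} \<inter> X) \<le> 10"
proof -
  define s where "s = (m + 3) div 4"
  have s: "1 \<le> s" "4 * s - 3 \<le> m" "m \<le> 4 * s" "s \<le> m"
    using assms(1) unfolding s_def by auto
  have small: "card (set (take k ps) \<inter> {a..b}) \<le> min k (length ps)" for k a b
  proof -
    have "card (set (take k ps) \<inter> {a..b}) \<le> card (set (take k ps))" by (intro card_mono) auto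
    also have "\<dots> \<le> length (take k ps)" by (rule card_length)
    finally show ?thesis by (simp add: min.commute)
  qed
  show ?thesis
  proof (cases "s \<le> length ps")
    case False
    then have "card (set (take k ps) \<inter> {a..b}) \<noteq> m" for k a b
      using small[of k a b] s by linarith
    then show ?thesis by (intro exI[of _ "{}"]) auto
  next
    case True
    define P where "P = set (take s ps)"
    have cardP: "card P = s"
      using True assms(2) unfolding P_def by (simp add: distinct_card)
    have "set ps = set (take s ps @ drop s ps)" by simp
    then have all: "set ps = P \<union> set (drop s ps)" unfolding P_def by (simp only: set_append)
    have dist: "set (drop s ps) \<inter> P = {}"
      using assms(2) unfolding P_def by (metis append_take_drop_id distinct_append inf_commute)
    obtain x where x: "x \<in> P" using cardP s(1) by fastforce
    have "interval_partition {UNIV :: 'a set}" unfolding interval_partition_def by auto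
    then obtain X where X: "X \<subseteq> P \<union> set (drop s ps)"
        "\<And>k. \<exists>\<C>. balanced s X \<C> (P \<union> set (take k (drop s ps)))"
      using sweep[of s P "{UNIV}" "{x}" P "drop s ps"] s cardP x dist assms(2)
      by (auto simp: P_def)
    have "1 \<le> card (set (take k ps) \<inter> {a..b} \<inter> X) \<and> card (set (take k ps) \<inter> {a..b} \<inter> X) \<le> 10"
      if m: "card (set (take k ps) \<inter> {a..b}) = m" for k a b
    proof -
      have "s \<le> k" using small[of k a b] m s by linarith
      then have "take k ps = take s ps @ take (k - s) (drop s ps)"
        by (metis le_add_diff_inverse take_add)
      then have "set (take k ps) = P \<union> set (take (k - s) (drop s ps))" unfolding P_def by simp
      then obtain \<C> where "balanced s X \<C> (set (take k ps))" using X(2) by metis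
      then show ?thesis using balanced_window[of s X \<C> "set (take k ps)" a b] s m by auto
    qed
    then show ?thesis using X(1) all by (intro exI[of _ X]) simp
  qed
qed

section \<open>Bottomless rectangles\<close>

lemma sorted_atMost_eq_take:
  fixes f :: "'b \<Rightarrow> 'a::linorder"
  assumes "sorted (map f vs)"
  shows "\<exists>k. set (take k vs) = {v \<in> set vs. f v \<le> c}"
  using assms
proof (induction vs)
  case (Cons v vs)
  show ?case
  proof (cases "f v \<le> c")
    case True
    obtain k where "set (take k vs) = {v \<in> set vs. f v \<le> c}" using Cons by auto
    then show ?thesis using True by (intro exI[of _ "Suc k"]) auto
  next
    case False
    then show ?thesis using Cons.prems by (intro exI[of _ 0]) force
  qed
qed simp

text \<open>
  List the points by increasing height. A bottomless rectangle of height \<open>c\<close> sees exactly a prefix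
  of this list, restricted to an interval of $x$-coordinates, and the projection to the $x$-axis is
  injective by general position, so all cardinalities can be computed on the axis.
\<close>

theorem theorem14:
  fixes m :: nat and V :: "(real \<times> real) set"
  assumes "m > 0"
    and "finite V"
    and "general_position V"
  shows "\<exists>X \<subseteq> V. shallow_hitting_set 10 (range_hypergraph V bottomless_rectangles m) X"
proof -
  have inj_fst: "inj_on fst V"
    using assms(3) unfolding general_position_def inj_on_def by metis
  have inj_snd: "inj_on snd V"
    using assms(3) unfolding general_position_def inj_on_def by metis
  define vs where "vs = map (the_inv_into V snd) (sorted_list_of_set (snd ` V))"
  have snd_vs: "map snd vs = sorted_list_of_set (snd ` V)"
    unfolding vs_def using assms(2) inj_snd
    by (auto simp: f_the_inv_into_f intro!: map_idI)
  then have sorted_vs: "sorted (map snd vs)" by simp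
  have set_vs: "set vs = V"
    unfolding vs_def using assms(2) inj_snd
    by (simp add: image_image the_inv_into_f_f)
  have dist: "distinct vs"
    using snd_vs distinct_map[of snd vs] by simp
  have "distinct (map fst vs)" using dist set_vs inj_fst by (simp add: distinct_map)
  then obtain X0 where X0: "X0 \<subseteq> fst ` V"
    "\<And>k a b. card (set (take k (map fst vs)) \<inter> {a..b}) = m \<Longrightarrow>
       1 \<le> card (set (take k (map fst vs)) \<inter> {a..b} \<inter> X0) \<and>
       card (set (take k (map fst vs)) \<inter> {a..b} \<inter> X0) \<le> 10"
    using shallow_hitting_set_consecutive[OF assms(1), of "map fst vs"] set_vs by auto
  define X where "X = {v \<in> V. fst v \<in> X0}"
  have "1 \<le> card (e \<inter> X) \<and> card (e \<inter> X) \<le> 10"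
    if e: "e \<subseteq> V" "card e = m" "R \<in> bottomless_rectangles" "e = V \<inter> R" for e R
  proof -
    obtain a b c where R: "R = {a..b} \<times> {..c}"
      using e(3) unfolding bottomless_rectangles_def by blast
    obtain k where below: "set (take k vs) = {v \<in> V. snd v \<le> c}"
      using sorted_atMost_eq_take[OF sorted_vs, of c] set_vs by auto
    have proj: "fst ` e = set (take k (map fst vs)) \<inter> {a..b}"
      unfolding e(4) R take_map set_map below by force
    have projX: "fst ` (e \<inter> X) = fst ` e \<inter> X0"
      using e(1) unfolding X_def by auto
    have "card (fst ` e) = card e" "card (fst ` (e \<inter> X)) = card (e \<inter> X)"
      using inj_fst e(1) by (auto intro!: card_image intro: inj_on_subset)
    then show ?thesis using X0(2)[of k a b] e(2) proj projX by simp
  qed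
  then have "shallow_hitting_set 10 (range_hypergraph V bottomless_rectangles m) X"
    unfolding shallow_hitting_set_def range_hypergraph_def X_def by auto
  moreover have "X \<subseteq> V" unfolding X_def by auto
  ultimately show ?thesis by blast
qed

end
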